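(* Let $b=(n_1,\ldots,n_m)$ be a block structure with $\sum_i n_i=N$, and let $A\in\mathbb{R}^{N\times N}$ be symmetric positive semidefinite with $A^{(i,i)}=I_{n_i}$ for all $i$. Let $X^*$ be an optimal solution of the semidefinite program $$\max_{X}\ \mathrm{trace}(AX)\quad\text{subject to}\quad \mathrm{trace}(X^{(i,i)})=1,\ i=1,\ldots,m,$$ where $X$ ranges over symmetric positive semidefinite $N\times N$ matrices, and let $x^*$ be an optimal solution of $$\max_{x\in\mathbb{R}^N}\ x^TAx\quad\text{subject to}\quad x^{(i)T}x^{(i)}=1,\ i=1,\ldots,m.$$ Let $x_k$ denote the $k$-th eigenvector of $X^*$ (eigenvalues in decreasing order), and assume $\|x_1^{(i)}\|>0$ for all $i=1,\ldots,m$. Let $\psi:=\mathrm{trace}(AX^* )$, $\phi:=\mathrm{trace}(Ax^*x^{*T})$, and let $p:=\pi(x_1)^TA\,\pi(x_1)$ be the objective value of the projected vector $\pi(x_1)$. Then $$\psi\ge\phi\ge p.$$ Moreover, if $X^*$ can be expressed as $X^*=\lambda_1x_1x_1^T+\lambda_2x_2x_2^T$, where $x_1$ and $x_2$ have unit length and $\lambda_1>1>\lambda_2$, then $$\psi-p\le\left(\frac{1}{1-\lambda_2}-1\right)m^2+\lambda_2\|A\|_2.$$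
   Context: Block notation: for $b=(n_1,\ldots,n_m)$ with $\sum_i n_i=N$, a vector $x\in\mathbb{R}^N$ is split into consecutive sub-vectors $x^{(i)}\in\mathbb{R}^{n_i}$, and a matrix $M\in\mathbb{R}^{N\times N}$ into blocks $M^{(i,j)}\in\mathbb{R}^{n_i\times n_j}$. For $y\in\mathbb{R}^N$ with all $\|y^{(i)}\|\neq0$, define $\pi(y):=\left(\frac{y^{(1)}}{\|y^{(1)}\|},\ldots,\frac{y^{(m)}}{\|y^{(m)}\|}\right)\in\mathbb{R}^N$. $\|\cdot\|$ is the Euclidean norm and $\|A\|_2$ the spectral norm. The eigenvectors $x_k$ of the symmetric matrix $X^*$ are taken orthonormal, so the displayed expression for $X^*$ is its spectral decomposition. *)

theory Defs
  imports Complex_Main "Jordan_Normal_Form.Char_Poly"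
begin

text \<open>A block structure is a list \<open>b\<close> of block sizes, with \<open>m = length b\<close> and
  \<open>N = sum_list b\<close>. Blocks and coordinates are numbered from 0.\<close>

definition block_offset :: "nat list \<Rightarrow> nat \<Rightarrow> nat" where
  "block_offset b i = sum_list (take i b)"

definition vec_block :: "nat list \<Rightarrow> 'a vec \<Rightarrow> nat \<Rightarrow> 'a vec" where
  "vec_block b y i = vec (b ! i) (\<lambda>k. y $ (block_offset b i + k))"

definition mat_block :: "nat list \<Rightarrow> 'a mat \<Rightarrow> nat \<Rightarrow> nat \<Rightarrow> 'a mat" where
  "mat_block b M i j =
     mat (b ! i) (b ! j) (\<lambda>(k, l). M $$ (block_offset b i + k, block_offset b j + l))"

definition vec_norm :: "real vec \<Rightarrow> real" where
  "vec_norm v = sqrt (v \<bullet> v)"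

definition block_proj :: "nat list \<Rightarrow> real vec \<Rightarrow> real vec" where
  "block_proj b y = vec_of_list (concat (map
     (\<lambda>i. list_of_vec ((1 / vec_norm (vec_block b y i)) \<cdot>\<^sub>v vec_block b y i)) [0..<length b]))"

definition mat_trace :: "'a :: comm_monoid_add mat \<Rightarrow> 'a" where
  "mat_trace M = (\<Sum>i<dim_row M. M $$ (i, i))"

definition outer_prod :: "real vec \<Rightarrow> real vec \<Rightarrow> real mat" where
  "outer_prod v w = mat (dim_vec v) (dim_vec w) (\<lambda>(i, j). v $ i * w $ j)"

text \<open>The operator norm induced by the Euclidean norm. The unit ball is used rather than the
  unit sphere so that the supremum is over a nonempty set also in dimension 0.\<close>

definition spectral_norm :: "real mat \<Rightarrow> real" where
  "spectral_norm M =
     (SUP v \<in> {v \<in> carrier_vec (dim_col M). vec_norm v \<le> 1}. vec_norm (M *\<^sub>v v))"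

definition sym_psd :: "nat \<Rightarrow> real mat \<Rightarrow> bool" where
  "sym_psd n M \<longleftrightarrow> M \<in> carrier_mat n n \<and> transpose_mat M = M \<and>
     (\<forall>v \<in> carrier_vec n. 0 \<le> v \<bullet> (M *\<^sub>v v))"

definition sdp_feasible :: "nat list \<Rightarrow> real mat \<Rightarrow> bool" where
  "sdp_feasible b X \<longleftrightarrow> sym_psd (sum_list b) X \<and>
     (\<forall>i < length b. mat_trace (mat_block b X i i) = 1)"

definition sdp_optimal :: "nat list \<Rightarrow> real mat \<Rightarrow> real mat \<Rightarrow> bool" where
  "sdp_optimal b A X \<longleftrightarrow> is_arg_max (\<lambda>Y. mat_trace (A * Y)) (sdp_feasible b) X"

definition qp_feasible :: "nat list \<Rightarrow> real vec \<Rightarrow> bool" where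
  "qp_feasible b x \<longleftrightarrow> x \<in> carrier_vec (sum_list b) \<and>
     (\<forall>i < length b. vec_block b x i \<bullet> vec_block b x i = 1)"

definition qp_optimal :: "nat list \<Rightarrow> real mat \<Rightarrow> real vec \<Rightarrow> bool" where
  "qp_optimal b A x \<longleftrightarrow> is_arg_max (\<lambda>y. y \<bullet> (A *\<^sub>v y)) (qp_feasible b) x"

text \<open>\<open>x 1, \<dots>, x n\<close> is an orthonormal basis of eigenvectors of \<open>M\<close>, with eigenvalues
  \<open>lam 1 \<ge> \<dots> \<ge> lam n\<close> repeated according to multiplicity.\<close>

definition ordered_eigenbasis ::
    "nat \<Rightarrow> real mat \<Rightarrow> (nat \<Rightarrow> real vec) \<Rightarrow> (nat \<Rightarrow> real) \<Rightarrow> bool" where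
  "ordered_eigenbasis n M x lam \<longleftrightarrow>
     (\<forall>k \<in> {1..n}. eigenvector M (x k) (lam k)) \<and>
     (\<forall>j \<in> {1..n}. \<forall>k \<in> {1..n}. x j \<bullet> x k = (if j = k then 1 else 0)) \<and>
     antimono_on {1..n} lam"

end

theory Submission
  imports Defs
begin

text \<open>Write \<open>z = sqrt \<lambda>\<^sub>1 x\<^sub>1\<close> and \<open>y = \<pi> x\<^sub>1\<close>. The trace constraint on the \<open>i\<close>-th diagonal block of \<open>X\<close>
  says that the \<open>i\<close>-th block of \<open>z\<close> is the \<open>i\<close>-th block of \<open>y\<close> scaled by a factor
  \<open>s\<^sub>i \<in> [sqrt (1 - \<lambda>\<^sub>2), 1]\<close>. Since \<open>A\<close> is positive semidefinite with identity diagonal blocks, it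
  pairs unit block vectors to numbers in \<open>[-1, 1]\<close>, so passing from \<open>z\<close> to \<open>y\<close> changes each of the
  \<open>m\<^sup>2\<close> terms of the quadratic form by at most \<open>1 - s\<^sub>i s\<^sub>j \<le> \<lambda>\<^sub>2 \<le> 1 / (1 - \<lambda>\<^sub>2) - 1\<close>. The second
  eigenvector contributes at most \<open>\<lambda>\<^sub>2\<close> times the spectral norm of \<open>A\<close>.\<close>

section \<open>Splitting sums, scalar products and bilinear forms along the blocks\<close>

lemma block_offset_Suc: "i < length b \<Longrightarrow> block_offset b (Suc i) = block_offset b i + b ! i"
  unfolding block_offset_def by (simp add: take_Suc_conv_app_nth)

lemma block_offset_index_less:
  assumes "i < length b" and "k < b ! i"
  shows "block_offset b i + k < sum_list b"
proof -
  have "sum_list b = sum_list (take (Suc i) b) + sum_list (drop (Suc i) b)"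
    by (metis append_take_drop_id sum_list_append)
  then show ?thesis
    using assms block_offset_Suc[OF assms(1)] unfolding block_offset_def by linarith
qed

lemma dim_vec_block [simp]: "dim_vec (vec_block b y i) = b ! i"
  by (simp add: vec_block_def)

text \<open>The blocks partition the coordinates; every block decomposition below rests on this. The
  induction appends a block at the end, since that leaves the offsets of all earlier blocks
  unchanged.\<close>

lemma sum_blocks:
  fixes g :: "nat \<Rightarrow> 'a :: comm_monoid_add"
  shows "(\<Sum>k<sum_list b. g k) = (\<Sum>i<length b. \<Sum>l<b ! i. g (block_offset b i + l))"
proof (induction b rule: rev_induct)
  case Nil
  then show ?case by simp
next
  case (snoc n b)
  have split: "(\<Sum>k<s + n. g k) = (\<Sum>k<s. g k) + (\<Sum>l<n. g (s + l))" for s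
    by (induction n) (simp_all add: add.assoc)
  show ?case
    by (simp add: split snoc.IH block_offset_def nth_append)
qed

lemma scalar_prod_lessThan: "v \<bullet> w = (\<Sum>i<dim_vec w. v $ i * w $ i)"
  by (simp add: scalar_prod_def lessThan_atLeast0)

lemma scalar_prod_blocks:
  assumes "dim_vec w = sum_list b"
  shows "v \<bullet> w = (\<Sum>i<length b. vec_block b v i \<bullet> vec_block b w i)"
  by (simp add: scalar_prod_lessThan assms sum_blocks vec_block_def)

lemma bilinear_lessThan:
  fixes A :: "'a :: comm_semiring_0 mat"
  assumes "A \<in> carrier_mat n m" and "dim_vec z = m"
  shows "y \<bullet> (A *\<^sub>v z) = (\<Sum>k<n. \<Sum>l<m. y $ k * (A $$ (k, l) * z $ l))"
proof -
  have "y \<bullet> (A *\<^sub>v z) = (\<Sum>k<n. y $ k * (A *\<^sub>v z) $ k)"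
    using assms by (simp add: scalar_prod_lessThan)
  also have "\<dots> = (\<Sum>k<n. y $ k * (\<Sum>l<m. A $$ (k, l) * z $ l))"
    using assms by (intro sum.cong refl) (auto simp: scalar_prod_lessThan)
  finally show ?thesis by (simp add: sum_distrib_left)
qed

lemma bilinear_blocks:
  fixes A :: "'a :: comm_semiring_0 mat"
  assumes A: "A \<in> carrier_mat (sum_list b) (sum_list b)" and z: "dim_vec z = sum_list b"
  shows "y \<bullet> (A *\<^sub>v z) = (\<Sum>i<length b. \<Sum>j<length b.
    vec_block b y i \<bullet> (mat_block b A i j *\<^sub>v vec_block b z j))"
proof -
  have "y \<bullet> (A *\<^sub>v z) = (\<Sum>i<length b. \<Sum>k<b ! i. \<Sum>j<length b. \<Sum>l<b ! j.
      y $ (block_offset b i + k) * (A $$ (block_offset b i + k, block_offset b j + l)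
        * z $ (block_offset b j + l)))"
    unfolding bilinear_lessThan[OF A z] sum_blocks ..
  also have "\<dots> = (\<Sum>i<length b. \<Sum>j<length b. \<Sum>k<b ! i. \<Sum>l<b ! j.
      y $ (block_offset b i + k) * (A $$ (block_offset b i + k, block_offset b j + l)
        * z $ (block_offset b j + l)))"
    by (intro sum.cong refl sum.swap)
  also have "\<dots> = (\<Sum>i<length b. \<Sum>j<length b.
      vec_block b y i \<bullet> (mat_block b A i j *\<^sub>v vec_block b z j))"
  proof (intro sum.cong refl)
    fix i j
    have "mat_block b A i j \<in> carrier_mat (b ! i) (b ! j)"
      by (simp add: mat_block_def)
    from bilinear_lessThan[OF this, of "vec_block b z j" "vec_block b y i"]
    show "(\<Sum>k<b ! i. \<Sum>l<b ! j. y $ (block_offset b i + k) *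
        (A $$ (block_offset b i + k, block_offset b j + l) * z $ (block_offset b j + l)))
      = vec_block b y i \<bullet> (mat_block b A i j *\<^sub>v vec_block b z j)"
      by (simp add: vec_block_def mat_block_def)
  qed
  finally show ?thesis .
qed

section \<open>Building a vector from prescribed blocks\<close>

text \<open>Stated for every prefix: \<open>m = i\<close> locates the start of block
  \<open>i\<close> in the concatenation, and \<open>m = length b\<close> gives the total
  dimension.\<close>

lemma length_concat_blocks:
  assumes "\<And>i. i < length b \<Longrightarrow> length (f i) = b ! i" and "m \<le> length b"
  shows "length (concat (map f [0..<m])) = block_offset b m"
  using assms(2)
proof (induction m)
  case 0
  then show ?case by (simp add: block_offset_def)
next
  case (Suc m)
  then show ?case by (simp add: block_offset_Suc assms(1))
qed

lemma nth_concat_blocks: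
  assumes f: "\<And>i. i < length b \<Longrightarrow> length (f i) = b ! i"
    and i: "i < length b" and k: "k < b ! i"
  shows "concat (map f [0..<length b]) ! (block_offset b i + k) = f i ! k"
proof -
  have "[0..<length b] = [0..<i] @ i # [Suc i..<length b]"
    using i upt_add_eq_append[of 0 i "length b - i"] upt_conv_Cons[OF i] by simp
  then show ?thesis
    using length_concat_blocks[of b f i, OF f] i k f[OF i] by (simp add: nth_append)
qed

text \<open>The concatenation inside \<open>block_proj\<close>, freed from normalization, so that it
  also yields test vectors with arbitrary blocks.\<close>

definition block_join :: "nat list \<Rightarrow> (nat \<Rightarrow> 'a vec) \<Rightarrow> 'a vec" where
  "block_join b u = vec_of_list (concat (map (\<lambda>i. list_of_vec (u i)) [0..<length b]))"

lemma dim_block_join: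
  assumes "\<And>i. i < length b \<Longrightarrow> dim_vec (u i) = b ! i"
  shows "dim_vec (block_join b u) = sum_list b"
  using length_concat_blocks[of b "\<lambda>i. list_of_vec (u i)" "length b"] assms
  by (simp add: block_join_def block_offset_def del: list_of_vec_map)

lemma vec_block_block_join:
  assumes "\<And>i. i < length b \<Longrightarrow> dim_vec (u i) = b ! i" and "i < length b"
  shows "vec_block b (block_join b u) i = u i"
proof (rule eq_vecI)
  fix k assume "k < dim_vec (u i)"
  then have k: "k < b ! i" using assms by simp
  show "vec_block b (block_join b u) i $ k = u i $ k"
    using nth_concat_blocks[of b "\<lambda>i. list_of_vec (u i)", OF _ assms(2) k] assms k
    by (simp add: vec_block_def block_join_def vec_of_list_index list_of_vec_index)
qed (use assms in simp)

lemma block_proj_eq_block_join: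
  "block_proj b y = block_join b (\<lambda>i. (1 / vec_norm (vec_block b y i)) \<cdot>\<^sub>v vec_block b y i)"
  by (simp add: block_proj_def block_join_def)

section \<open>Euclidean norm and feasibility of the projected vector\<close>

lemma vec_norm_square: "(vec_norm v)\<^sup>2 = v \<bullet> v"
  by (simp add: vec_norm_def scalar_prod_lessThan sum_nonneg)

lemma scalar_prod_self_nonneg: "0 \<le> v \<bullet> (v :: real vec)"
  by (simp add: scalar_prod_lessThan sum_nonneg)

lemma qp_feasible_block_proj:
  assumes "\<And>i. i < length b \<Longrightarrow> 0 < vec_norm (vec_block b y i)"
  shows "qp_feasible b (block_proj b y)"
  unfolding qp_feasible_def
proof (intro conjI allI impI)
  let ?u = "\<lambda>i. (1 / vec_norm (vec_block b y i)) \<cdot>\<^sub>v vec_block b y i"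
  have dims: "dim_vec (?u i) = b ! i" for i by simp
  show "block_proj b y \<in> carrier_vec (sum_list b)"
    unfolding block_proj_eq_block_join by (rule carrier_vecI, rule dim_block_join[OF dims])
  fix i assume i: "i < length b"
  have "?u i \<bullet> ?u i = (1 / vec_norm (vec_block b y i))\<^sup>2 * (vec_norm (vec_block b y i))\<^sup>2"
    unfolding vec_norm_square by (simp add: power2_eq_square)
  also have "\<dots> = 1" using assms[OF i] by (simp add: power_divide)
  finally show "vec_block b (block_proj b y) i \<bullet> vec_block b (block_proj b y) i = 1"
    unfolding block_proj_eq_block_join vec_block_block_join[OF dims i] .
qed

section \<open>Rank-one matrices and the semidefinite relaxation\<close>

lemma outer_prod_carrier: "v \<in> carrier_vec n \<Longrightarrow> outer_prod v v \<in> carrier_mat n n"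
  by (simp add: outer_prod_def)

lemma scalar_prod_outer_prod:
  assumes "v \<in> carrier_vec n" and "w \<in> carrier_vec n"
  shows "v \<bullet> (outer_prod w w *\<^sub>v v) = (w \<bullet> v)\<^sup>2"
proof -
  have "v \<bullet> (outer_prod w w *\<^sub>v v) = (\<Sum>k<n. \<Sum>l<n. (w $ k * v $ k) * (w $ l * v $ l))"
    using assms by (subst bilinear_lessThan[of _ n n])
      (auto simp: outer_prod_def intro!: sum.cong)
  then show ?thesis
    using assms by (simp add: power2_eq_square scalar_prod_lessThan sum_product)
qed

lemma sym_psd_outer_prod:
  assumes "v \<in> carrier_vec n"
  shows "sym_psd n (outer_prod v v)"
  unfolding sym_psd_def
proof (intro conjI ballI)
  show "transpose_mat (outer_prod v v) = outer_prod v v"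
    by (rule eq_matI) (auto simp: outer_prod_def)
qed (use assms in \<open>simp_all add: outer_prod_carrier scalar_prod_outer_prod\<close>)

lemma mat_trace_outer_prod: "mat_trace (outer_prod v v) = v \<bullet> v"
  by (simp add: mat_trace_def outer_prod_def scalar_prod_lessThan)

lemma mat_block_outer_prod:
  assumes "dim_vec v = sum_list b" and "i < length b" and "j < length b"
  shows "mat_block b (outer_prod v v) i j = outer_prod (vec_block b v i) (vec_block b v j)"
  by (rule eq_matI)
    (use assms in \<open>auto simp: mat_block_def outer_prod_def vec_block_def block_offset_index_less\<close>)

lemma outer_prod_dims [simp]:
  "dim_row (outer_prod v w) = dim_vec v" "dim_col (outer_prod v w) = dim_vec w"
  by (simp_all add: outer_prod_def)

lemma mat_trace_mult_outer_prod:
  assumes A: "A \<in> carrier_mat n n" and v: "v \<in> carrier_vec n"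
  shows "mat_trace (A * outer_prod v v) = v \<bullet> (A *\<^sub>v v)"
proof -
  have "mat_trace (A * outer_prod v v) = (\<Sum>k<n. \<Sum>l<n. A $$ (k, l) * (v $ l * v $ k))"
    unfolding mat_trace_def using A v
    by (auto intro!: sum.cong simp: scalar_prod_lessThan outer_prod_def)
  then show ?thesis
    using v by (simp add: bilinear_lessThan[OF A] ac_simps)
qed

text \<open>The semidefinite program relaxes the quadratic one: the diagonal block traces of
  \<open>outer_prod v v\<close> are the squared block norms of \<open>v\<close>. This is the source
  of \<open>phi \<le> psi\<close>.\<close>

lemma sdp_feasible_outer_prod:
  assumes "qp_feasible b v"
  shows "sdp_feasible b (outer_prod v v)"
  using assms unfolding qp_feasible_def sdp_feasible_def
  by (auto simp: sym_psd_outer_prod mat_block_outer_prod mat_trace_outer_prod)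

lemma mat_trace_add:
  assumes "P \<in> carrier_mat n n" and "Q \<in> carrier_mat n n"
  shows "mat_trace (P + Q) = mat_trace P + mat_trace Q"
  using assms by (simp add: mat_trace_def sum.distrib)

lemma mat_trace_smult: "mat_trace (c \<cdot>\<^sub>m P) = c * mat_trace (P :: real mat)" if "P \<in> carrier_mat n n"
  using that by (simp add: mat_trace_def sum_distrib_left)

section \<open>Cauchy-Schwarz and the spectral norm\<close>

lemma scalar_prod_unit_le_vec_norm:
  assumes u: "u \<in> carrier_vec n" "u \<bullet> u = 1" and w: "w \<in> carrier_vec n"
  shows "u \<bullet> w \<le> vec_norm w"
proof -
  have "0 \<le> w \<bullet> w - 2 * t * (u \<bullet> w) + t\<^sup>2 * (u \<bullet> u)" for t
  proof -
    have "0 \<le> (\<Sum>i<n. (w $ i - t * u $ i)\<^sup>2)"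
      by (simp add: sum_nonneg)
    also have "\<dots> = (\<Sum>i<n. w $ i * w $ i - 2 * t * (u $ i * w $ i) + t\<^sup>2 * (u $ i * u $ i))"
      by (intro sum.cong refl) (simp add: power2_eq_square algebra_simps)
    also have "\<dots> = w \<bullet> w - 2 * t * (u \<bullet> w) + t\<^sup>2 * (u \<bullet> u)"
      using u(1) w
      by (simp add: sum.distrib sum_subtractf scalar_prod_lessThan flip: sum_distrib_left)
    finally show ?thesis .
  qed
  \<comment> \<open>The value \<open>t = u \<bullet> w\<close> minimizes the squared norm of
    \<open>w - t u\<close>.\<close>
  from this[of "u \<bullet> w"] have "(u \<bullet> w)\<^sup>2 \<le> w \<bullet> w"
    using u by (simp add: power2_eq_square)
  then show ?thesis
    unfolding vec_norm_def by (rule real_le_rsqrt)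
qed

text \<open>A real supremum bounds its members only if the set is bounded above, so the work lies in
  bounding \<open>M\<close> on the unit ball.\<close>

lemma vec_norm_mult_le_spectral_norm:
  assumes "v \<in> carrier_vec (dim_col M)" and "vec_norm v \<le> 1"
  shows "vec_norm (M *\<^sub>v v) \<le> spectral_norm M"
  unfolding spectral_norm_def
proof (rule cSUP_upper)
  show "v \<in> {v \<in> carrier_vec (dim_col M). vec_norm v \<le> 1}"
    using assms by simp
  \<comment> \<open>Vectors of the unit ball have entries of modulus at most 1, so the absolute row
    sums \<open>?C i\<close> bound the entries of their images.\<close>
  let ?C = "\<lambda>i. \<Sum>j<dim_col M. \<bar>M $$ (i, j)\<bar>"
  show "bdd_above ((\<lambda>v. vec_norm (M *\<^sub>v v)) ` {v \<in> carrier_vec (dim_col M). vec_norm v \<le> 1})"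
  proof (rule bdd_aboveI2)
    fix u assume "u \<in> {v \<in> carrier_vec (dim_col M). vec_norm v \<le> 1}"
    then have u: "dim_vec u = dim_col M" "vec_norm u \<le> 1" by auto
    have entry: "\<bar>u $ j\<bar> \<le> 1" if "j < dim_col M" for j
    proof -
      have "(u $ j)\<^sup>2 \<le> (\<Sum>i<dim_col M. (u $ i)\<^sup>2)"
        using that by (intro member_le_sum) auto
      also have "\<dots> = u \<bullet> u" using u by (simp add: scalar_prod_lessThan power2_eq_square)
      also have "\<dots> \<le> 1" using u by (simp add: vec_norm_def)
      finally show ?thesis by (simp add: abs_square_le_1)
    qed
    have "(M *\<^sub>v u) $ i * (M *\<^sub>v u) $ i \<le> (?C i)\<^sup>2" if i: "i < dim_row M" for i
    proof -
      have "\<bar>(M *\<^sub>v u) $ i\<bar> \<le> (\<Sum>j<dim_col M. \<bar>M $$ (i, j) * u $ j\<bar>)"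
        using i u by (simp add: scalar_prod_lessThan)
      also have "\<dots> \<le> ?C i"
        by (intro sum_mono) (simp add: abs_mult mult_left_le entry)
      finally show ?thesis
        by (simp add: power2_eq_square[symmetric] abs_le_square_iff[symmetric] sum_nonneg)
    qed
    then have "(M *\<^sub>v u) \<bullet> (M *\<^sub>v u) \<le> (\<Sum>i<dim_row M. (?C i)\<^sup>2)"
      unfolding scalar_prod_lessThan by (auto intro: sum_mono simp del: index_mult_mat_vec)
    then show "vec_norm (M *\<^sub>v u) \<le> sqrt (\<Sum>i<dim_row M. (?C i)\<^sup>2)"
      by (simp add: vec_norm_def)
  qed
qed

section \<open>Effect of rescaling blocks on the quadratic form\<close>

text \<open>Reduces the form to an \<open>m\<close> by \<open>m\<close> array of numbers: rescaling
  the blocks changes only the weights \<open>c i * c j\<close>, not the pairings of the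
  \<open>u i\<close>.\<close>

lemma quadratic_form_block_combination:
  fixes A :: "'a :: field mat"
  assumes "A \<in> carrier_mat (sum_list b) (sum_list b)" and "dim_vec y = sum_list b"
    and y: "\<And>i. i < length b \<Longrightarrow> vec_block b y i = c i \<cdot>\<^sub>v u i"
    and u: "\<And>i. i < length b \<Longrightarrow> u i \<in> carrier_vec (b ! i)"
  shows "y \<bullet> (A *\<^sub>v y) =
    (\<Sum>i<length b. \<Sum>j<length b. c i * c j * (u i \<bullet> (mat_block b A i j *\<^sub>v u j)))"
  unfolding bilinear_blocks[OF assms(1,2)]
proof (intro sum.cong refl)
  fix i j assume "i \<in> {..<length b}" "j \<in> {..<length b}"
  then have ui: "u i \<in> carrier_vec (b ! i)" and uj: "u j \<in> carrier_vec (b ! j)"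
    and yi: "vec_block b y i = c i \<cdot>\<^sub>v u i" and yj: "vec_block b y j = c j \<cdot>\<^sub>v u j"
    using y u by auto
  have M: "mat_block b A i j \<in> carrier_mat (b ! i) (b ! j)"
    by (simp add: mat_block_def)
  show "vec_block b y i \<bullet> (mat_block b A i j *\<^sub>v vec_block b y j)
      = c i * c j * (u i \<bullet> (mat_block b A i j *\<^sub>v u j))"
    unfolding yi yj mult_mat_vec[OF M uj] using M ui uj by simp
qed

text \<open>Testing the form on \<open>e_i + t e_j\<close> gives
  \<open>1 + 2 * t * a i j + t\<^sup>2 \<ge> 0\<close>; the values 1 and -1 of \<open>t\<close>
  bound \<open>a i j\<close> from below and from above.\<close>

lemma abs_le_one_of_psd_form:
  fixes a :: "nat \<Rightarrow> nat \<Rightarrow> real"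
  assumes psd: "\<And>c. 0 \<le> (\<Sum>i<m. \<Sum>j<m. c i * c j * a i j)"
    and sym: "\<And>i j. i < m \<Longrightarrow> j < m \<Longrightarrow> a i j = a j i"
    and diag: "\<And>i. i < m \<Longrightarrow> a i i = 1"
    and i: "i < m" and j: "j < m"
  shows "\<bar>a i j\<bar> \<le> 1"
proof (cases "i = j")
  case True
  then show ?thesis using diag i by simp
next
  case False
  have "0 \<le> 1 + 2 * t * a i j + t\<^sup>2" for t
  proof -
    define c where "c k = (if k = i then 1 else 0) + (if k = j then t else 0)" for k
    have c: "(\<Sum>k<m. c k * f k) = f i + t * f j" for f
      using i j by (simp add: c_def distrib_right sum.distrib if_distrib[of "\<lambda>z. z * _"] cong: if_cong)
    have "0 \<le> (\<Sum>k<m. \<Sum>l<m. c k * c l * a k l)" by (rule psd)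
    also have "\<dots> = (\<Sum>k<m. c k * (\<Sum>l<m. c l * a k l))"
      by (simp add: sum_distrib_left mult.assoc)
    also have "\<dots> = a i i + t * a i j + t * (a j i + t * a j j)"
      by (simp add: c)
    finally show ?thesis
      using sym[OF i j] diag[OF i] diag[OF j] by (simp add: power2_eq_square algebra_simps)
  qed
  from this[of 1] this[of "-1"] show ?thesis by simp
qed

text \<open>With \<open>a i j\<close> the pairing of the unit blocks of \<open>y\<close> through
  \<open>A\<close>, the difference is the sum of \<open>(s i * s j - 1) * a i j\<close>. The array
  \<open>a\<close> inherits semidefiniteness and a unit diagonal from \<open>A\<close>, so each term
  is at most \<open>1 - s i * s j\<close>, hence at most \<open>e\<close>.\<close>

lemma block_scaling_bound:
  assumes A: "sym_psd (sum_list b) A"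
    and A_diag: "\<And>i. i < length b \<Longrightarrow> mat_block b A i i = 1\<^sub>m (b ! i)"
    and y: "qp_feasible b y" and z: "dim_vec z = sum_list b"
    and zy: "\<And>i. i < length b \<Longrightarrow> vec_block b z i = s i \<cdot>\<^sub>v vec_block b y i"
    and s: "\<And>i. i < length b \<Longrightarrow> 0 \<le> s i \<and> s i \<le> 1 \<and> 1 - e \<le> (s i)\<^sup>2"
    and e: "e \<le> 1"
  shows "z \<bullet> (A *\<^sub>v z) - y \<bullet> (A *\<^sub>v y) \<le> e * (real (length b))\<^sup>2"
proof -
  define u where "u = vec_block b y"
  define a where "a i j = u i \<bullet> (mat_block b A i j *\<^sub>v u j)" for i j
  have Ac: "A \<in> carrier_mat (sum_list b) (sum_list b)" and At: "transpose_mat A = A"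
    using A by (auto simp: sym_psd_def)
  have yd: "dim_vec y = sum_list b" using y by (auto simp: qp_feasible_def)
  have u: "u i \<in> carrier_vec (b ! i)" for i
    unfolding u_def by (rule carrier_vecI) simp
  have psd: "0 \<le> (\<Sum>i<length b. \<Sum>j<length b. c i * c j * a i j)" for c
  proof -
    \<comment> \<open>A vector whose blocks are multiples of those of \<open>y\<close> transfers
      semidefiniteness from \<open>A\<close> to the array \<open>a\<close>.\<close>
    let ?w = "block_join b (\<lambda>i. c i \<cdot>\<^sub>v u i)"
    have dims: "dim_vec (c i \<cdot>\<^sub>v u i) = b ! i" for i using u[of i] by simp
    have w: "dim_vec ?w = sum_list b" by (rule dim_block_join[OF dims])
    have "0 \<le> ?w \<bullet> (A *\<^sub>v ?w)"
      using A carrier_vecI[OF w] unfolding sym_psd_def by blast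
    also have "\<dots> = (\<Sum>i<length b. \<Sum>j<length b. c i * c j * a i j)"
      unfolding a_def
      by (rule quadratic_form_block_combination[OF Ac w vec_block_block_join[OF dims] u])
    finally show ?thesis .
  qed
  have sym: "a i j = a j i" if "i < length b" "j < length b" for i j
  proof -
    have M: "mat_block b A k l \<in> carrier_mat (b ! k) (b ! l)" for k l
      by (simp add: mat_block_def)
    have AA: "A $$ (k, l) = A $$ (l, k)" if "k < sum_list b" "l < sum_list b" for k l
      using that Ac At by (metis carrier_matD index_transpose_mat(1))
    have d: "dim_vec (u k) = b ! k" for k using u[of k] by simp
    have "a i j = (\<Sum>k<b ! i. \<Sum>l<b ! j. u i $ k * (mat_block b A i j $$ (k, l) * u j $ l))"
      unfolding a_def by (rule bilinear_lessThan[OF M d])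
    also have "\<dots> = (\<Sum>k<b ! i. \<Sum>l<b ! j. u j $ l * (mat_block b A j i $$ (l, k) * u i $ k))"
      by (intro sum.cong refl) (auto simp: mat_block_def block_offset_index_less that AA)
    also have "\<dots> = (\<Sum>l<b ! j. \<Sum>k<b ! i. u j $ l * (mat_block b A j i $$ (l, k) * u i $ k))"
      by (rule sum.swap)
    also have "\<dots> = a j i"
      unfolding a_def by (rule bilinear_lessThan[OF M d, symmetric])
    finally show ?thesis .
  qed
  have diag: "a i i = 1" if "i < length b" for i
    using that y u[of i] unfolding a_def A_diag[OF that] by (simp add: qp_feasible_def u_def)
  have "z \<bullet> (A *\<^sub>v z) - y \<bullet> (A *\<^sub>v y)
      = (\<Sum>i<length b. \<Sum>j<length b. s i * s j * a i j) - (\<Sum>i<length b. \<Sum>j<length b. 1 * 1 * a i j)"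
    unfolding a_def
    by (subst quadratic_form_block_combination[OF Ac z, of s u],
        use zy u in \<open>simp_all add: u_def\<close>,
        subst quadratic_form_block_combination[OF Ac yd, of "\<lambda>_. 1" u],
        use u in \<open>simp_all add: u_def\<close>)
  also have "\<dots> = (\<Sum>i<length b. \<Sum>j<length b. (s i * s j - 1) * a i j)"
    by (simp add: sum_subtractf left_diff_distrib)
  also have "\<dots> \<le> (\<Sum>i<length b. \<Sum>j<length b. e)"
  proof (intro sum_mono)
    fix i j assume "i \<in> {..<length b}" "j \<in> {..<length b}"
    then have ij: "i < length b" "j < length b" by auto
    \<comment> \<open>The lower bounds are given for squares, so they are multiplied first and the
      root is taken afterwards; \<open>e \<le> 1\<close> keeps \<open>1 - e\<close> nonnegative for
      both steps.\<close>
    have "(1 - e)\<^sup>2 \<le> (s i)\<^sup>2 * (s j)\<^sup>2"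
      unfolding power2_eq_square[of "1 - e"] using s ij e by (intro mult_mono) auto
    then have lower: "1 - e \<le> s i * s j"
      using s ij by (auto intro: power2_le_imp_le[of _ "s i * s j"] simp: power_mult_distrib)
    have upper: "s i * s j \<le> 1"
      using s ij by (intro mult_le_one) auto
    have "\<bar>a i j\<bar> \<le> 1" by (rule abs_le_one_of_psd_form[OF psd sym diag ij])
    \<comment> \<open>The factor is nonnegative, so the worst case is
      \<open>a i j = -1\<close>.\<close>
    then have "(1 - s i * s j) * - a i j \<le> (1 - s i * s j) * 1"
      using upper by (intro mult_left_mono) auto
    then show "(s i * s j - 1) * a i j \<le> e"
      using lower by (simp add: algebra_simps)
  qed
  also have "\<dots> = e * (real (length b))\<^sup>2"
    by (simp add: power2_eq_square)
  finally show ?thesis .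
qed

text \<open>Serves the case of dimension 0. The zero vector lies in the unit ball, so the supremum
  is taken over \<open>{0}\<close> and not over the empty set.\<close>

lemma spectral_norm_dim_row_0:
  assumes "dim_row M = 0"
  shows "spectral_norm M = 0"
proof -
  have "0\<^sub>v (dim_col M) \<in> {v \<in> carrier_vec (dim_col M). vec_norm v \<le> 1}"
    by (simp add: vec_norm_def)
  moreover have "vec_norm (M *\<^sub>v v) = 0" for v
    using assms by (simp add: vec_norm_def scalar_prod_lessThan)
  ultimately have "(\<lambda>v. vec_norm (M *\<^sub>v v)) ` {v \<in> carrier_vec (dim_col M). vec_norm v \<le> 1} = {0}"
    by (auto simp only: image_iff)
  then show ?thesis
    unfolding spectral_norm_def by simp
qed

section \<open>The gap for a feasible matrix of rank at most two\<close>

text \<open>Here \<open>v\<close>, \<open>w\<close> stand for the two eigenvectors and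
  \<open>c\<close>, \<open>d\<close> for their eigenvalues. The trace splits into the form at
  \<open>sqrt c \<cdot>\<^sub>v v\<close>, compared with the projection by
  \<open>block_scaling_bound\<close> with \<open>e = d\<close>, and \<open>d\<close> times the form
  at \<open>w\<close>.\<close>

lemma rank_two_gap:
  assumes A: "sym_psd (sum_list b) A"
    and A_diag: "\<And>i. i < length b \<Longrightarrow> mat_block b A i i = 1\<^sub>m (b ! i)"
    and X: "sdp_feasible b (c \<cdot>\<^sub>m outer_prod v v + d \<cdot>\<^sub>m outer_prod w w)"
    and v: "v \<in> carrier_vec (sum_list b)"
    and w: "w \<in> carrier_vec (sum_list b)" "w \<bullet> w = 1"
    and vw: "w \<bullet> v = 0"
    and c: "0 \<le> c" and d: "d < 1"
    and pos: "\<And>i. i < length b \<Longrightarrow> 0 < vec_norm (vec_block b v i)"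
  shows "mat_trace (A * (c \<cdot>\<^sub>m outer_prod v v + d \<cdot>\<^sub>m outer_prod w w))
      - block_proj b v \<bullet> (A *\<^sub>v block_proj b v)
    \<le> (1 / (1 - d) - 1) * (real (length b))\<^sup>2 + d * spectral_norm A"
proof -
  let ?n = "sum_list b"
  let ?X = "c \<cdot>\<^sub>m outer_prod v v + d \<cdot>\<^sub>m outer_prod w w"
  define r where "r i = vec_norm (vec_block b v i)" for i
  have Ac: "A \<in> carrier_mat ?n ?n" using A by (simp add: sym_psd_def)
  have ov: "outer_prod v v \<in> carrier_mat ?n ?n" and ow: "outer_prod w w \<in> carrier_mat ?n ?n"
    using v w by (simp_all add: outer_prod_carrier)
  \<comment> \<open>Since \<open>w\<close> is a unit vector orthogonal to \<open>v\<close>, its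
    Rayleigh quotient isolates \<open>d\<close>, and semidefiniteness makes it nonnegative.\<close>
  have d0: "0 \<le> d"
  proof -
    have "w \<bullet> (?X *\<^sub>v w) = c * (w \<bullet> (outer_prod v v *\<^sub>v w)) + d * (w \<bullet> (outer_prod w w *\<^sub>v w))"
      using v w ov ow
      by (simp add: bilinear_lessThan[of _ ?n ?n] sum.distrib sum_distrib_left algebra_simps)
    also have "\<dots> = d"
      using v w vw by (simp add: scalar_prod_outer_prod comm_scalar_prod[of v ?n w])
    finally show ?thesis
      using X w by (auto simp: sdp_feasible_def sym_psd_def)
  qed
  \<comment> \<open>The trace constraint ties the block norms of \<open>v\<close> to those of
    \<open>w\<close>; it determines the scaling factors below.\<close>
  have block: "c * (r i)\<^sup>2 + d * (vec_block b w i \<bullet> vec_block b w i) = 1" if i: "i < length b" for i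
  proof -
    have "mat_block b ?X i i = c \<cdot>\<^sub>m mat_block b (outer_prod v v) i i + d \<cdot>\<^sub>m mat_block b (outer_prod w w) i i"
      by (rule eq_matI) (use v w i in \<open>auto simp: mat_block_def block_offset_index_less\<close>)
    also have "\<dots> = c \<cdot>\<^sub>m outer_prod (vec_block b v i) (vec_block b v i)
        + d \<cdot>\<^sub>m outer_prod (vec_block b w i) (vec_block b w i)"
      using v w i by (simp add: mat_block_outer_prod)
    also have "mat_trace \<dots>
        = c * (vec_block b v i \<bullet> vec_block b v i) + d * (vec_block b w i \<bullet> vec_block b w i)"
      by (subst mat_trace_add[of _ "b ! i"])
        (simp_all add: outer_prod_carrier carrier_vecI mat_trace_smult[of _ "b ! i"]
          mat_trace_outer_prod)
    finally have "mat_trace (mat_block b ?X i i)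
        = c * (vec_block b v i \<bullet> vec_block b v i) + d * (vec_block b w i \<bullet> vec_block b w i)" .
    then show ?thesis
      using X i by (simp add: sdp_feasible_def r_def vec_norm_square)
  qed
  have q: "vec_block b w i \<bullet> vec_block b w i \<le> 1" if "i < length b" for i
  proof -
    have "vec_block b w i \<bullet> vec_block b w i
        \<le> (\<Sum>j<length b. vec_block b w j \<bullet> vec_block b w j)"
      using that by (intro member_le_sum) (auto simp: scalar_prod_self_nonneg)
    then show ?thesis using w scalar_prod_blocks[of w b w] by simp
  qed
  let ?z = "sqrt c \<cdot>\<^sub>v v"
  have "?z \<bullet> (A *\<^sub>v ?z) - block_proj b v \<bullet> (A *\<^sub>v block_proj b v) \<le> d * (real (length b))\<^sup>2"
  \<comment> \<open>The projected blocks have unit length, so the factor \<open>sqrt c * r i\<close>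
    is the norm of block \<open>i\<close> of \<open>?z\<close>.\<close>
  proof (rule block_scaling_bound[OF A A_diag, where s = "\<lambda>i. sqrt c * r i"])
    show "qp_feasible b (block_proj b v)" by (rule qp_feasible_block_proj[OF pos])
    show "dim_vec ?z = ?n" using v by simp
    show "d \<le> 1" using d by simp
    fix i assume i: "i < length b"
    show "vec_block b ?z i = (sqrt c * r i) \<cdot>\<^sub>v vec_block b (block_proj b v) i"
      unfolding block_proj_eq_block_join
      by (subst vec_block_block_join[OF _ i])
        (use v pos[OF i] in \<open>auto simp: r_def vec_block_def block_offset_index_less[OF i]\<close>)
    have "(sqrt c * r i)\<^sup>2 = 1 - d * (vec_block b w i \<bullet> vec_block b w i)"
      using block[OF i] c by (simp add: power_mult_distrib)
    moreover have "0 \<le> d * (vec_block b w i \<bullet> vec_block b w i)"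
      using d0 by (simp add: scalar_prod_self_nonneg)
    moreover have "d * (vec_block b w i \<bullet> vec_block b w i) \<le> d"
      using d0 q[OF i] by (simp add: mult_left_le)
    moreover have "0 \<le> sqrt c * r i"
      using c pos[OF i] by (simp add: r_def)
    ultimately show "0 \<le> sqrt c * r i \<and> sqrt c * r i \<le> 1 \<and> 1 - d \<le> (sqrt c * r i)\<^sup>2"
      using power2_le_imp_le[of "sqrt c * r i" 1] by simp
  qed
  moreover have "?z \<bullet> (A *\<^sub>v ?z) = c * (v \<bullet> (A *\<^sub>v v))"
  proof -
    have "A *\<^sub>v ?z = sqrt c \<cdot>\<^sub>v (A *\<^sub>v v)"
      using Ac v by (rule mult_mat_vec)
    then show ?thesis using Ac v c by (simp add: mult.assoc[symmetric])
  qed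
  moreover have "mat_trace (A * ?X) = c * (v \<bullet> (A *\<^sub>v v)) + d * (w \<bullet> (A *\<^sub>v w))"
  proof -
    have "A * ?X = c \<cdot>\<^sub>m (A * outer_prod v v) + d \<cdot>\<^sub>m (A * outer_prod w w)"
      using Ac ov ow by (simp add: mult_add_distrib_mat[of _ ?n ?n _ ?n] mult_smult_distrib[of _ ?n ?n _ ?n])
    then show ?thesis
      using Ac ov ow v w
      by (simp add: mat_trace_add[of _ ?n] mat_trace_smult[of _ ?n] mat_trace_mult_outer_prod)
  qed
  moreover have "d * (w \<bullet> (A *\<^sub>v w)) \<le> d * spectral_norm A"
  proof (rule mult_left_mono[OF _ d0])
    have "w \<bullet> (A *\<^sub>v w) \<le> vec_norm (A *\<^sub>v w)"
      using Ac w by (intro scalar_prod_unit_le_vec_norm) auto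
    also have "\<dots> \<le> spectral_norm A"
      using Ac w by (intro vec_norm_mult_le_spectral_norm) (auto simp: vec_norm_def)
    finally show "w \<bullet> (A *\<^sub>v w) \<le> spectral_norm A" .
  qed
  moreover have "d * (real (length b))\<^sup>2 \<le> (1 / (1 - d) - 1) * (real (length b))\<^sup>2"
  proof (rule mult_right_mono)
    \<comment> \<open>After multiplication by \<open>1 - d > 0\<close> the claim reads
      \<open>d - d * d \<le> d\<close>.\<close>
    have "d * d \<ge> 0" using d0 by simp
    then show "d \<le> 1 / (1 - d) - 1" using d by (simp add: field_simps)
  qed simp
  ultimately show ?thesis by linarith
qed

section \<open>Small dimensions and the resulting inequalities\<close>

text \<open>Positive sizes with sum 1 leave a single block of size 1, and its trace constraint
  forces \<open>X\<close> to be the 1 by 1 identity.\<close>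

lemma eigenvalue_one_dim:
  assumes X: "sdp_feasible b X" and one: "sum_list b = 1"
    and pos: "\<And>i. i < length b \<Longrightarrow> 0 < b ! i"
    and v: "eigenvector X v k" "v \<bullet> v = 1"
  shows "k = 1"
proof -
  have Xc: "X \<in> carrier_mat 1 1" using X one by (simp add: sdp_feasible_def sym_psd_def)
  have ne: "0 < length b" using one by (cases b) auto
  have "b ! 0 = 1"
    \<comment> \<open>The last index of block 0 lies below the total 1, so the size of the block is
      at most 1.\<close>
    using pos[OF ne] block_offset_index_less[OF ne, of "b ! 0 - 1"] one by simp
  then have X00: "X $$ (0, 0) = 1"
    using X ne by (auto simp: sdp_feasible_def mat_trace_def mat_block_def block_offset_def)
  have vc: "v \<in> carrier_vec 1" and Xv: "X *\<^sub>v v = k \<cdot>\<^sub>v v"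
    using v Xc by (auto simp: eigenvector_def)
  have "k = v \<bullet> (X *\<^sub>v v)" using v vc unfolding Xv by simp
  also have "\<dots> = v \<bullet> v"
    using Xc vc X00 by (simp add: bilinear_lessThan[of _ 1 1] scalar_prod_lessThan)
  finally show ?thesis using v by simp
qed

theorem proposition3p4:
  fixes b :: "nat list" and N :: nat
    and A X :: "real mat" and xopt :: "real vec"
    and x :: "nat \<Rightarrow> real vec" and lam :: "nat \<Rightarrow> real"
    and psi phi p :: real
  assumes N: "N = sum_list b"
    and A_psd: "sym_psd N A"
    and A_diag: "\<And>i. i < length b \<Longrightarrow> mat_block b A i i = 1\<^sub>m (b ! i)"
    and X_opt: "sdp_optimal b A X"
    and xopt_opt: "qp_optimal b A xopt"
    and eig: "ordered_eigenbasis N X x lam"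
    and x1_pos: "\<And>i. i < length b \<Longrightarrow> 0 < vec_norm (vec_block b (x 1) i)"
    and psi: "psi = mat_trace (A * X)"
    and phi: "phi = mat_trace (A * outer_prod xopt xopt)"
    and p: "p = block_proj b (x 1) \<bullet> (A *\<^sub>v block_proj b (x 1))"
  shows "psi \<ge> phi \<and> phi \<ge> p \<and>
    (X = lam 1 \<cdot>\<^sub>m outer_prod (x 1) (x 1) + lam 2 \<cdot>\<^sub>m outer_prod (x 2) (x 2) \<and>
       lam 1 > 1 \<and> 1 > lam 2 \<longrightarrow>
     psi - p \<le> (1 / (1 - lam 2) - 1) * (real (length b))\<^sup>2 + lam 2 * spectral_norm A)"
proof (intro conjI impI)
  have Ac: "A \<in> carrier_mat N N" using A_psd by (simp add: sym_psd_def)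
  have xopt: "qp_feasible b xopt" using xopt_opt by (simp add: qp_optimal_def is_arg_max_def)
  have X: "sdp_feasible b X" using X_opt by (simp add: sdp_optimal_def is_arg_max_def)
  have phi': "phi = xopt \<bullet> (A *\<^sub>v xopt)"
    unfolding phi using Ac xopt N by (intro mat_trace_mult_outer_prod) (auto simp: qp_feasible_def)
  show "phi \<le> psi"
    unfolding phi psi using X_opt sdp_feasible_outer_prod[OF xopt]
    by (auto simp: sdp_optimal_def is_arg_max_def not_less)
  show "p \<le> phi"
    unfolding phi' p using xopt_opt qp_feasible_block_proj[of b "x 1", OF x1_pos]
    by (auto simp: qp_optimal_def is_arg_max_def not_less)
  assume asm: "X = lam 1 \<cdot>\<^sub>m outer_prod (x 1) (x 1) + lam 2 \<cdot>\<^sub>m outer_prod (x 2) (x 2) \<and>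
       lam 1 > 1 \<and> 1 > lam 2"
  \<comment> \<open>An empty block would have norm 0, against \<open>x1_pos\<close>.\<close>
  have b_pos: "0 < b ! i" if "i < length b" for i
    using x1_pos[OF that] by (cases "b ! i = 0") (auto simp: vec_norm_def scalar_prod_lessThan)
  have eigv: "eigenvector X (x k) (lam k)" "x k \<bullet> x k = 1" if "k \<in> {1..N}" for k
    using eig that by (auto simp: ordered_eigenbasis_def)
  \<comment> \<open>The eigenbasis is indexed by \<open>{1..N}\<close>, so \<open>x 2\<close> is
    known to be an eigenvector only from \<open>N = 2\<close> on.\<close>
  consider "N = 0" | "N = 1" | "N \<ge> 2" by linarith
  then show "psi - p \<le> (1 / (1 - lam 2) - 1) * (real (length b))\<^sup>2 + lam 2 * spectral_norm A"
  proof cases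
    case 1
    \<comment> \<open>Without blocks, \<open>psi\<close>, \<open>p\<close> and both terms of the
      bound vanish.\<close>
    then have "b = []" using b_pos N by (cases b) force+
    then show ?thesis
      using 1 Ac qp_feasible_block_proj[of b "x 1"] unfolding psi p
      by (simp add: spectral_norm_dim_row_0 mat_trace_def scalar_prod_lessThan)
  next
    case 2
    \<comment> \<open>Here \<open>x 2\<close> and \<open>lam 2\<close> are unconstrained, but \<open>lam 1 > 1\<close> fails.\<close>
    then have "lam 1 = 1"
      using eigenvalue_one_dim[OF X _ b_pos eigv[of 1]] N by simp
    then show ?thesis using asm by simp
  next
    case 3
    have "X \<in> carrier_mat N N" using X N by (simp add: sdp_feasible_def sym_psd_def)
    then have "x 1 \<in> carrier_vec N" "x 2 \<in> carrier_vec N"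
      using eigv(1)[of 1] eigv(1)[of 2] 3 by (auto simp: eigenvector_def)
    moreover have "x 2 \<bullet> x 1 = 0"
      using eig 3 unfolding ordered_eigenbasis_def by fastforce
    ultimately show ?thesis
      using rank_two_gap[of b A "lam 1" "x 1" "lam 2" "x 2"] A_psd A_diag X asm eigv(2)[of 2] 3 x1_pos
      unfolding psi p N by auto
  qed
qed

end
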